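(* Let $\lambda\in(0,1)$ and let $n\ge 0$ be an integer. Then $$d_{n,\lambda}=n!\sum_{l=0}^n\Big(\frac{1}{1-\lambda}\Big)^{n-l+1}\frac{(-1)^l}{l!}\,\langle 1\rangle_{l,\lambda}.$$
   Context: For $\lambda\in(0,1)$ the degenerate derangement numbers $d_{n,\lambda}$ are defined by the generating function $\frac{1}{1-\lambda-t}(1+\lambda t)^{-1/\lambda}=\sum_{n=0}^\infty d_{n,\lambda}\frac{t^n}{n!}$. Here $\langle 1\rangle_{0,\lambda}=1$ and $\langle 1\rangle_{l,\lambda}=1\cdot(1+\lambda)(1+2\lambda)\cdots(1+(l-1)\lambda)$ for $l\ge1$. *)

theory Defs
  imports "HOL-Analysis.Analysis"
begin

definition degenerate_derangement_egf :: "real \<Rightarrow> real \<Rightarrow> real" where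
  "degenerate_derangement_egf lam t = 1 / (1 - lam - t) * (1 + lam * t) powr (- 1 / lam)"

text \<open>
  The generating function identity is read as an identity of real functions of \<open>t\<close> near \<open>0\<close>;
  for \<open>0 < lam < 1\<close> it determines the coefficient sequence uniquely, see
  \<open>degenerate_derangement_egf_ex1\<close> below.
\<close>

definition degenerate_derangement :: "real \<Rightarrow> nat \<Rightarrow> real" where
  "degenerate_derangement lam =
     (THE d. \<forall>\<^sub>F t in nhds 0.
        (\<lambda>n. d n * (t ^ n / fact n)) sums degenerate_derangement_egf lam t)"

definition degenerate_rising_factorial :: "real \<Rightarrow> real \<Rightarrow> nat \<Rightarrow> real" where
  "degenerate_rising_factorial lam x l = (\<Prod>k<l. x + real k * lam)"

lemma eventually_sums_iff_has_fps_expansion: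
  fixes f :: "real \<Rightarrow> real"
  shows "(\<forall>\<^sub>F t in nhds 0. (\<lambda>n. d n * (t ^ n / fact n)) sums f t) \<longleftrightarrow>
         f has_fps_expansion Abs_fps (\<lambda>n. d n / fact n)" (is "?L \<longleftrightarrow> f has_fps_expansion ?F")
proof
  assume ?L
  then obtain e where e: "e > 0"
    "\<And>t. dist t 0 < e \<Longrightarrow> (\<lambda>n. d n * (t ^ n / fact n)) sums f t"
    unfolding eventually_nhds_metric by blast
  have s: "(\<lambda>n. fps_nth ?F n * t ^ n) sums f t" if "\<bar>t\<bar> < e" for t
    using e(2)[of t] that by (simp add: field_simps)
  have "summable (\<lambda>n. fps_nth ?F n * (e / 2) ^ n)"
    using s[of "e / 2"] e(1) by (auto simp: sums_iff)
  then have "fps_conv_radius ?F \<ge> norm (e / 2)"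
    unfolding fps_conv_radius_def by (rule conv_radius_geI)
  then have "fps_conv_radius ?F > 0"
    using e(1) less_le_trans[of 0 "ereal (norm (e / 2))"] by auto
  moreover have "\<forall>\<^sub>F t in nhds 0. eval_fps ?F t = f t"
    unfolding eventually_nhds_metric eval_fps_def
    using e(1) s by (auto simp: sums_iff dist_norm intro!: exI[of _ e])
  ultimately show "f has_fps_expansion ?F"
    by (simp add: has_fps_expansion_def)
next
  assume F: "f has_fps_expansion ?F"
  have "eventually (\<lambda>t. t \<in> eball 0 (fps_conv_radius ?F)) (nhds 0)"
    using F by (intro eventually_nhds_in_open) (auto simp: has_fps_expansion_def zero_ereal_def)
  moreover have "eventually (\<lambda>t. eval_fps ?F t = f t) (nhds 0)"
    using F by (simp add: has_fps_expansion_def)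
  ultimately show ?L
  proof eventually_elim
    case (elim t)
    then have "(\<lambda>n. fps_nth ?F n * t ^ n) sums f t"
      using sums_eval_fps[of t ?F] by auto
    then show ?case by (simp add: field_simps)
  qed
qed

lemma has_fps_expansion_nth_unique_real:
  fixes f :: "real \<Rightarrow> real"
  assumes "f has_fps_expansion F" "f has_fps_expansion G"
  shows "fps_nth F n = fps_nth G n"
  using assms
proof (induction n arbitrary: f F G)
  case 0
  then have "eval_fps F 0 = f 0" "eval_fps G 0 = f 0"
    unfolding has_fps_expansion_def by (auto dest: eventually_nhds_x_imp_x)
  then show ?case by (simp add: eval_fps_at_0)
next
  case (Suc n)
  have "fps_nth (fps_deriv F) n = fps_nth (fps_deriv G) n"
    using Suc.prems by (intro Suc.IH[of "deriv f"] has_fps_expansion_deriv)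
  then show ?case by (simp del: of_nat_Suc)
qed

lemma degenerate_derangement_egf_ex1:
  assumes "0 < lam" "lam < 1"
  shows "\<exists>!d. \<forall>\<^sub>F t in nhds 0.
           (\<lambda>n. d n * (t ^ n / fact n)) sums degenerate_derangement_egf lam t"
proof -
  define a where "a = - 1 / lam"
  define G where "G = Abs_fps (\<lambda>n. fact n * ((a gchoose n) * lam ^ n) / fact n)"
  define F where "F = inverse (fps_const (1 - lam) - fps_X) * G"
  have "\<forall>\<^sub>F t in nhds 0. (\<lambda>n. (fact n * ((a gchoose n) * lam ^ n)) * (t ^ n / fact n)) sums
          ((1 + lam * t) powr a)"
    unfolding eventually_nhds_metric
  proof (intro exI[of _ 1] conjI allI impI)
    fix t :: real assume "dist t 0 < 1"
    then have "\<bar>lam * t\<bar> < 1"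
      using assms by (auto simp: abs_mult intro: mult_less_le_imp_less[of _ 1 _ 1, simplified]
          le_less_trans[OF mult_right_le_one_le])
    from gen_binomial_real[OF this, of a]
    show "(\<lambda>n. (fact n * ((a gchoose n) * lam ^ n)) * (t ^ n / fact n)) sums
            ((1 + lam * t) powr a)"
      by (simp add: power_mult_distrib mult_ac)
  qed auto
  then have "(\<lambda>t. (1 + lam * t) powr a) has_fps_expansion G"
    unfolding G_def eventually_sums_iff_has_fps_expansion .
  then have "(\<lambda>t. inverse (1 - lam - t) * (1 + lam * t) powr a) has_fps_expansion F"
    unfolding F_def using assms by (intro fps_expansion_intros) auto
  then have F: "degenerate_derangement_egf lam has_fps_expansion F"
    by (simp add: degenerate_derangement_egf_def[abs_def] a_def divide_inverse)
  show ?thesis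
    unfolding eventually_sums_iff_has_fps_expansion
  proof (rule ex1I[of _ "\<lambda>n. fact n * fps_nth F n"])
    show "degenerate_derangement_egf lam has_fps_expansion
            Abs_fps (\<lambda>n. fact n * fps_nth F n / fact n)"
      using F by (simp add: fps_nth_inverse)
  next
    fix d assume d: "degenerate_derangement_egf lam has_fps_expansion Abs_fps (\<lambda>n. d n / fact n)"
    show "d = (\<lambda>n. fact n * fps_nth F n)"
      using has_fps_expansion_nth_unique_real[OF d F] by (auto simp: fun_eq_iff field_simps)
  qed
qed

lemma degenerate_derangement_sums:
  assumes "0 < lam" "lam < 1"
  shows "\<forall>\<^sub>F t in nhds 0.
           (\<lambda>n. degenerate_derangement lam n * (t ^ n / fact n)) sums degenerate_derangement_egf lam t"
  unfolding degenerate_derangement_def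
  by (rule theI'[OF degenerate_derangement_egf_ex1[OF assms]])

end

theory Submission
  imports Defs
begin

text \<open>
  The factor \<open>(1 + lam t) powr (-1/lam)\<close> is a binomial series whose \<open>l\<close>-th coefficient is
  \<open>(-1)^l / l!\<close> times the degenerate rising factorial, and \<open>1 / (1 - lam - t)\<close> is a geometric
  series. The claim is their Cauchy product.
\<close>

text \<open>Each of the \<open>l\<close> factors \<open>- x / lam - i\<close> of the falling product
  absorbs one \<open>lam\<close> and becomes \<open>- (x + i * lam)\<close>; the signs collect to
  \<open>(- 1) ^ l\<close>.\<close>

lemma gbinomial_mult_power_eq_degenerate_rising_factorial:
  assumes "lam \<noteq> 0"
  shows "((- x / lam) gchoose l) * lam ^ l =
           (- 1) ^ l / fact l * degenerate_rising_factorial lam x l"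
proof -
  have "(\<Prod>i<l. - x / lam - real i) * lam ^ l = (\<Prod>i<l. (- x / lam - real i) * lam)"
    by (simp add: prod.distrib)
  also have "\<dots> = (\<Prod>i<l. (- 1) * (x + real i * lam))"
    using assms by (intro prod.cong) (auto simp: field_simps)
  also have "\<dots> = (- 1) ^ l * degenerate_rising_factorial lam x l"
    by (simp only: prod.distrib degenerate_rising_factorial_def prod_constant card_lessThan)
  finally show ?thesis
    by (simp add: gbinomial_prod_rev atLeast0LessThan field_simps)
qed

lemma has_fps_expansion_one_plus_mult_powr:
  fixes a c :: real
  shows "(\<lambda>t. (1 + c * t) powr a) has_fps_expansion Abs_fps (\<lambda>n. (a gchoose n) * c ^ n)"
proof -
  have "((\<lambda>t. c * t) \<longlongrightarrow> c * 0) (nhds 0)"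
    by (intro tendsto_intros filterlim_ident)
  then have "\<forall>\<^sub>F t in nhds 0. norm (c * t) < 1"
    using order_tendstoD(2)[OF tendsto_norm, of "\<lambda>t. c * t" 0 "nhds 0" 1] by simp
  \<comment> \<open>The binomial series in \<open>c * t\<close>, padded with a cancelling
    \<open>fact n\<close> to fit the exponential form of
    \<open>eventually_sums_iff_has_fps_expansion\<close>.\<close>
  then have "\<forall>\<^sub>F t in nhds 0. (\<lambda>n. (fact n * ((a gchoose n) * c ^ n)) * (t ^ n / fact n)) sums
               ((1 + c * t) powr a)"
  proof eventually_elim
    case (elim t)
    then show ?case
      using gen_binomial_real[of "c * t" a] by (simp add: power_mult_distrib mult_ac)
  qed
  then show ?thesis
    unfolding eventually_sums_iff_has_fps_expansion by simp
qed

text \<open>Geometric series: in the product with \<open>fps_const c - fps_X\<close>, coefficient 0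
  is \<open>c * (1 / c)\<close>, and each later one cancels as
  \<open>c * (1 / c) ^ (n + 1) - (1 / c) ^ n\<close>.\<close>

lemma inverse_fps_const_minus_X:
  fixes c :: "'a :: field"
  assumes "c \<noteq> 0"
  shows "inverse (fps_const c - fps_X) = Abs_fps (\<lambda>n. (1 / c) ^ (n + 1))"
proof (rule fps_inverse_unique, rule fps_ext)
  fix n
  show "fps_nth ((fps_const c - fps_X) * Abs_fps (\<lambda>n. (1 / c) ^ (n + 1))) n = fps_nth 1 n"
    using assms by (cases n) (auto simp: left_diff_distrib)
qed

theorem theorem5:
  fixes lam :: real and n :: nat
  assumes "0 < lam" and "lam < 1"
  shows "degenerate_derangement lam n =
    fact n * (\<Sum>l=0..n. (1 / (1 - lam)) ^ (n - l + 1) * ((- 1) ^ l / fact l) *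
                          degenerate_rising_factorial lam 1 l)"
proof -
  define G where "G = Abs_fps (\<lambda>l. (- 1) ^ l / fact l * degenerate_rising_factorial lam 1 l)"
  define H where "H = Abs_fps (\<lambda>n. (1 / (1 - lam)) ^ (n + 1))"
  have G: "(\<lambda>t. (1 + lam * t) powr (- 1 / lam)) has_fps_expansion G"
    using has_fps_expansion_one_plus_mult_powr[of lam "- 1 / lam"] assms
    by (simp only: G_def gbinomial_mult_power_eq_degenerate_rising_factorial)
  \<comment> \<open>Inverting the series requires a nonzero constant term; here it is
    \<open>1 - lam\<close>, positive by \<open>lam < 1\<close>.\<close>
  have "(\<lambda>t. inverse (1 - lam - t)) has_fps_expansion inverse (fps_const (1 - lam) - fps_X)"
    using assms by (intro fps_expansion_intros) auto
  then have "(\<lambda>t. inverse (1 - lam - t)) has_fps_expansion H"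
    using assms by (simp add: H_def inverse_fps_const_minus_X)
  from has_fps_expansion_mult[OF this G]
  have "degenerate_derangement_egf lam has_fps_expansion H * G"
    by (simp add: degenerate_derangement_egf_def[abs_def] divide_inverse)
  moreover have "degenerate_derangement_egf lam has_fps_expansion
      Abs_fps (\<lambda>n. degenerate_derangement lam n / fact n)"
    using degenerate_derangement_sums[OF assms]
    unfolding eventually_sums_iff_has_fps_expansion .
  \<comment> \<open>Both series expand the same function at 0, so their coefficients agree.\<close>
  ultimately have "fps_nth (Abs_fps (\<lambda>n. degenerate_derangement lam n / fact n)) n =
      fps_nth (H * G) n"
    by (intro has_fps_expansion_nth_unique_real)
  \<comment> \<open>With \<open>G\<close> first, the Cauchy product puts index \<open>l\<close> on
    \<open>G\<close> and \<open>n - l\<close> on \<open>H\<close>, as in the claim.\<close>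
  also have "fps_nth (H * G) n = fps_nth (G * H) n"
    by (simp only: mult.commute)
  also have "\<dots> = (\<Sum>l=0..n. (1 / (1 - lam)) ^ (n - l + 1) * ((- 1) ^ l / fact l) *
                          degenerate_rising_factorial lam 1 l)"
    unfolding fps_mult_nth by (intro sum.cong) (simp_all add: G_def H_def mult_ac)
  finally show ?thesis
    by (simp only: fps_nth_Abs_fps nonzero_divide_eq_eq[OF fact_nonzero] mult.commute)
qed

end
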